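(* Let $X$ be a metric space with metric $d$, $T\colon X \to X$ a mapping, and $R$ a nonempty subset of $X \times X$. Then the following are equivalent: (1) $T$ is a Meir-Keeler type mapping on $R$, that is, for any $\epsilon > 0$ there exists $\delta >0$ such that $(x,y)\in R$ and $\epsilon \leq d(x,y) < \epsilon + \delta$ imply $d(Tx,Ty) < \epsilon$; (2) for any $\epsilon > 0$ there exists $\delta >0$ such that $(x,y)\in R$ and $d(x,y) < \epsilon + \delta$ imply $d(Tx,Ty) < \epsilon$; (3) there exists a nondecreasing function $\gamma \colon \mathbb{R}_+ \to [0,\infty]$ such that $\gamma(s) > s$ for all $s>0$ and $\gamma\bigl( d(Tx,Ty) \bigr) \leq d(x,y)$ for all $(x,y) \in R$; (4) there exists a function $w\colon \mathbb{R}_+ \to \mathbb{R}_+$ such that $w(s) > s$ for all $s>0$, $w$ is right lower semicontinuous on $(0,\infty)$, and $w\bigl( d(Tx,Ty) \bigr) \leq d(x,y)$ for all $(x,y) \in R$; (5) there exists a function $l\colon (0,\infty) \to \mathbb{R}_+$ of type (L) such that $d(Tx,Ty) < l \bigl( d(x,y) \bigr)$ for all $(x,y) \in R$ with $x \ne y$; (6) there exist a nondecreasing function $\phi \colon \mathbb{R}_+ \to [0,\infty]$ and a function $\psi \colon \mathbb{R}_+ \to \mathbb{R}_+$ such that $\psi$ is right upper semicontinuous on $(0,\infty)$, $\phi(t) > \psi(t)$ for all $t >0$, and $\phi \bigl( d(Tx,Ty) \bigr) \leq \psi \bigl( d(x,y) \bigr)$ for all $(x,y) \in R$. Moreover, in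 (5), one can choose $l$ to be a right continuous and nondecreasing function such that $l(s) > 0$ for all $s>0$ (that is, whenever these conditions hold, there is a function $l$ as in (5) having these additional properties).
   Context: $\mathbb{R}_+$ denotes the set of nonnegative real numbers. A function $l$ from $\mathbb{R}_+$ or $(0,\infty)$ to $\mathbb{R}_+$ is of type (L) if for any $s>0$ there exists $\delta >0$ such that $l(t) \leq s$ for all $t \in [s, s+\delta]$. A function $w\colon \mathbb{R}_+ \to \mathbb{R}$ is right lower semicontinuous at $t_0\in \mathbb{R}_+$ if for any $\epsilon > 0$ there exists $\delta > 0$ such that $w(t_0) - \epsilon < w(s)$ for all $s \in [t_0, t_0 + \delta)$; a function $\psi\colon \mathbb{R}_+ \to \mathbb{R}$ is right upper semicontinuous at $t_0$ if $-\psi$ is right lower semicontinuous at $t_0$. Such a property holds on $(0,\infty)$ if it holds at every point of $(0,\infty)$. *)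

theory Defs
  imports "HOL-Library.Extended_Nonnegative_Real" "HOL-Library.FuncSet"
begin

text \<open>
  Functions on \<open>[0,\<infinity>)\<close> or \<open>(0,\<infinity>)\<close> are represented by functions on the type \<^typ>\<open>real\<close>;
  values outside the intended domain are irrelevant: every condition below evaluates
  its function only inside that domain.
\<close>

definition meir_keeler_on :: "('a::metric_space \<times> 'a) set \<Rightarrow> ('a \<Rightarrow> 'a) \<Rightarrow> bool" where
  "meir_keeler_on R T \<longleftrightarrow>
    (\<forall>\<epsilon>>0. \<exists>\<delta>>0. \<forall>(x, y)\<in>R.
       \<epsilon> \<le> dist x y \<and> dist x y < \<epsilon> + \<delta> \<longrightarrow> dist (T x) (T y) < \<epsilon>)"

text \<open>
  The codomain condition (nonnegative values) is not part of this predicate and is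
  stated separately, since it depends on whether the domain includes \<open>0\<close>.
\<close>

definition type_L :: "(real \<Rightarrow> real) \<Rightarrow> bool" where
  "type_L l \<longleftrightarrow> (\<forall>s>0. \<exists>\<delta>>0. \<forall>t\<in>{s..s + \<delta>}. l t \<le> s)"

definition right_lsc_at :: "real \<Rightarrow> (real \<Rightarrow> real) \<Rightarrow> bool" where
  "right_lsc_at t\<^sub>0 w \<longleftrightarrow> (\<forall>\<epsilon>>0. \<exists>\<delta>>0. \<forall>s\<in>{t\<^sub>0..<t\<^sub>0 + \<delta>}. w t\<^sub>0 - \<epsilon> < w s)"

definition right_usc_at :: "real \<Rightarrow> (real \<Rightarrow> real) \<Rightarrow> bool" where
  "right_usc_at t\<^sub>0 \<psi> \<longleftrightarrow> right_lsc_at t\<^sub>0 (\<lambda>t. - \<psi> t)"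

end

theory Submission imports Defs begin

text \<open>
  Write \<open>a = d(x,y)\<close> and \<open>b = d(Tx,Ty)\<close> for \<open>(x,y) \<in> R\<close>. All the conditions describe the
  planar set of pairs \<open>(a,b)\<close> near the diagonal. The conditions are compared through a
  common witness: a real, nondecreasing \<open>w\<close> with \<open>s < w(s) \<le> 2s\<close> for \<open>s > 0\<close> and
  \<open>w(b) \<le> a\<close>. The infimum of all \<open>a\<close> that occur with some \<open>b \<ge> s\<close>, capped at \<open>2s\<close>, is such
  a \<open>w\<close>: the uniform form of the Meir--Keeler condition says precisely that this infimum
  exceeds \<open>s\<close> (\<open>gauge_of_uniform\<close>). Being monotone, \<open>w\<close> is right lower semicontinuous, so
  it serves as \<open>\<gamma>\<close>, as \<open>w\<close> and, together with the identity as \<open>\<psi>\<close>, as \<open>\<phi>\<close>. The ways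
  back from a given function to the Meir--Keeler condition each use once, at \<open>\<epsilon>\<close>, its local
  regularity: right semicontinuity or type (L).

  The real work is to find a function \<open>l\<close> of type (L), because of the strict inequality
  \<open>b < l(a)\<close>. The idea is to put \<open>l(t) = inf {s. t < h(s)}\<close> for a nondecreasing \<open>h\<close> above the
  identity. Such a generalized inverse is automatically nondecreasing, right continuous and
  of type (L), since \<open>t < h(s)\<close> implies \<open>l(t) \<le> s\<close> (\<open>generalized_inverse_type_L\<close>). For \<open>b < l(a)\<close> it does not suffice that
  \<open>h(b) \<le> a\<close>; one needs \<open>h(u) \<le> a\<close> for some \<open>u > b\<close>, and \<open>w\<close> may jump immediately to the
  right of \<open>b\<close>. So \<open>w\<close> is first lowered to an \<open>h\<close> that is still above the identity but is
  bounded by \<open>w(b)\<close> on the whole interval from \<open>b\<close> to the midpoint of \<open>b\<close> and \<open>w(b)\<close>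
  (\<open>exists_delayed_gauge\<close>).
\<close>

section \<open>Nondecreasing functions above the identity\<close>

text \<open>
  The name refers to the fact that every jump of \<open>w\<close> is delayed: \<open>h\<close> takes no value above
  \<open>w b\<close> until some point beyond \<open>b\<close>. One lets \<open>h s\<close> be the infimum of all \<open>w b\<close> for which \<open>s\<close>
  lies between \<open>b\<close> and the midpoint of \<open>b\<close> and \<open>w b\<close>. That \<open>h s > s\<close> survives the infimum is
  due to the monotonicity of \<open>w\<close>: a single \<open>b1 < s\<close> in the competition already gives the
  bound \<open>2 * s - b1\<close> for all others, by \<open>w b \<ge> w b1\<close> to its right and by the midpoint condition
  to its left.
\<close>

lemma exists_delayed_gauge:
  fixes w :: "real \<Rightarrow> real"
  assumes mono: "mono_on {0..} w" and above: "\<And>s. s > 0 \<Longrightarrow> s < w s"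
  obtains h where "mono_on {0<..} h" and "\<And>s. s > 0 \<Longrightarrow> s < h s" and "\<And>s. s > 0 \<Longrightarrow> h s \<le> w s"
    and "\<And>b. b > 0 \<Longrightarrow> \<exists>u>b. h u \<le> w b"
proof -
  define C where "C = (\<lambda>s. {b. 0 < b \<and> b \<le> s \<and> s < (b + w b) / 2})"
  define h where "h = (\<lambda>s. Inf (w ` C s))"
  have self: "s \<in> C s" if "s > 0" for s
    using that above[OF that] by (auto simp: C_def)
  have bdd: "bdd_below (w ` C s)" for s
  proof (rule bdd_belowI2)
    show "0 \<le> w b" if "b \<in> C s" for b
      using that above[of b] by (auto simp: C_def)
  qed
  have le: "h s \<le> w b" if "b \<in> C s" for s b
    unfolding h_def using bdd that by (intro cInf_lower) auto
  have h_gt: "s < h s" if s: "s > 0" for s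
  proof (cases "\<exists>b1\<in>C s. b1 < s")
    case True
    then obtain b1 where b1: "b1 \<in> C s" "b1 < s" by blast
    have "2 * s - b1 \<le> h s"
      unfolding h_def
    proof (rule cINF_greatest)
      show "C s \<noteq> {}" using b1 by auto
      fix b assume b: "b \<in> C s"
      show "2 * s - b1 \<le> w b"
      proof (cases "b1 \<le> b")
        case True
        then have "w b1 \<le> w b"
          using b b1 mono by (auto simp: C_def intro: mono_onD)
        then show ?thesis using b1 by (auto simp: C_def)
      next
        case False
        then show ?thesis using b by (auto simp: C_def)
      qed
    qed
    then show ?thesis using b1 by simp
  next
    case False
    then have "C s = {s}" using self[OF s] by (force simp: C_def)
    then show ?thesis using above[OF s] by (simp add: h_def)
  qed
  have h_mono: "h s \<le> h s'" if "s > 0" "s \<le> s'" for s s'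
    unfolding h_def
  proof (rule cINF_greatest)
    show "C s' \<noteq> {}" using self[of s'] that by auto
    fix b assume b: "b \<in> C s'"
    have "h s \<le> w b"
    proof (cases "b \<le> s")
      case True
      then have "b \<in> C s" using b that by (auto simp: C_def)
      then show ?thesis by (rule le)
    next
      case False
      then have "w s \<le> w b" using that by (intro mono_onD[OF mono]) auto
      then show ?thesis using le[OF self[of s]] that by simp
    qed
    then show "Inf (w ` C s) \<le> w b" by (simp add: h_def)
  qed
  have delay: "\<exists>u>b. h u \<le> w b" if b: "b > 0" for b
  proof -
    obtain u where u: "b < u" "u < (b + w b) / 2"
      using dense[of b "(b + w b) / 2"] above[OF b] by auto
    then have "b \<in> C u" using b by (auto simp: C_def)
    then show ?thesis using u(1) le by blast
  qed
  show thesis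
  proof
    show "mono_on {0<..} h" using h_mono by (auto intro!: mono_onI)
  qed (use h_gt le self delay in auto)
qed

definition generalized_inverse :: "(real \<Rightarrow> real) \<Rightarrow> real \<Rightarrow> real" where
  "generalized_inverse h t = Inf {s. s > 0 \<and> t < h s}"

text \<open>
  The generalized inverse of any nondecreasing function above the identity is of type (L):
  between \<open>s\<close> and \<open>h s\<close> it is at most \<open>s\<close> by its very definition. Right continuity
  comes from the strict inequality \<open>t < h s\<close> in the definition, which persists for slightly
  larger \<open>t\<close>. The upper bound on \<open>h\<close> makes the inverse positive.
\<close>

lemma generalized_inverse_type_L:
  fixes h :: "real \<Rightarrow> real"
  assumes mono: "mono_on {0<..} h" and above: "\<And>s. s > 0 \<Longrightarrow> s < h s"
    and upper: "\<And>s. s > 0 \<Longrightarrow> h s \<le> 2 * s"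
  defines "l \<equiv> generalized_inverse h"
  shows "type_L l" and "mono_on {0<..} l" and "\<And>t. t > 0 \<Longrightarrow> l t > 0"
    and "\<And>t. t > 0 \<Longrightarrow> continuous (at_right t) l"
    and "\<And>t u. t > 0 \<Longrightarrow> u > 0 \<Longrightarrow> h u \<le> t \<Longrightarrow> u \<le> l t"
proof -
  define E where "E = (\<lambda>t. {s. s > 0 \<and> t < h s})"
  have l_eq: "l t = Inf (E t)" for t by (simp add: l_def E_def generalized_inverse_def)
  have ne: "t \<in> E t" if "t > 0" for t using above that by (auto simp: E_def)
  have bdd: "bdd_below (E t)" for t by (rule bdd_belowI[of _ 0]) (auto simp: E_def)
  have le: "l t \<le> s" if "s > 0" "t < h s" for s t
    unfolding l_eq using bdd that by (intro cInf_lower) (auto simp: E_def)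
  have l_mono: "l t \<le> l t'" if "0 < t" "t \<le> t'" for t t'
    unfolding l_eq
  proof (rule cInf_superset_mono)
    show "E t' \<noteq> {}" using ne[of t'] that by auto
    show "E t' \<subseteq> E t" using that by (auto simp: E_def)
  qed (rule bdd)
  show "mono_on {0<..} l" using l_mono by (auto intro!: mono_onI)
  show "type_L l"
    unfolding type_L_def
  proof (intro allI impI)
    fix s :: real assume s: "s > 0"
    show "\<exists>\<delta>>0. \<forall>t\<in>{s..s + \<delta>}. l t \<le> s"
      using above[OF s] le[OF s] by (intro exI[of _ "(h s - s) / 2"]) (auto simp: field_simps)
  qed
  show "u \<le> l t" if "t > 0" "u > 0" "h u \<le> t" for t u
    unfolding l_eq
  proof (rule cInf_greatest)
    show "E t \<noteq> {}" using ne that by auto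
    fix s assume s: "s \<in> E t"
    show "u \<le> s"
    proof (rule ccontr)
      assume "\<not> u \<le> s"
      then have "h s \<le> h u" using s that by (intro mono_onD[OF mono]) (auto simp: E_def)
      then show False using s that by (auto simp: E_def)
    qed
  qed
  show "l t > 0" if t: "t > 0" for t
  proof -
    have "t / 2 \<le> l t"
      unfolding l_eq
    proof (rule cInf_greatest)
      show "E t \<noteq> {}" using ne t by auto
      show "t / 2 \<le> s" if "s \<in> E t" for s using that upper[of s] by (auto simp: E_def)
    qed
    then show ?thesis using t by linarith
  qed
  show "continuous (at_right t) l" if t: "t > 0" for t
    unfolding continuous_within
  proof (rule order_tendstoI)
    fix c assume "c < l t"
    then have "c < l u" if "t < u" for u using l_mono[of t u] t that by linarith
    then show "\<forall>\<^sub>F u in at_right t. c < l u" by (auto simp: eventually_at_filter)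
  next
    fix c assume "l t < c"
    then obtain s where s: "s > 0" "t < h s" "s < c"
      using cInf_lessD[of "E t" c] ne[OF t] unfolding l_eq by (auto simp: E_def)
    have "\<forall>\<^sub>F u in at_right t. u < h s"
      using s(2) eventually_at_right_field by blast
    then show "\<forall>\<^sub>F u in at_right t. l u < c"
      by (rule eventually_mono) (use le[OF s(1)] s(3) in fastforce)
  qed
qed

section \<open>From the Meir--Keeler condition to its characterizations\<close>

text \<open>
  The values of \<open>d(x,y)\<close> below \<open>\<epsilon>\<close> are harmless: applied at \<open>\<epsilon> = d(x,y)\<close>, the condition shows
  that \<open>T\<close> strictly decreases positive distances.
\<close>

lemma meir_keeler_on_uniform:
  assumes "meir_keeler_on R T" "\<epsilon> > 0"
  shows "\<exists>\<delta>>0. \<forall>(x, y)\<in>R. dist x y < \<epsilon> + \<delta> \<longrightarrow> dist (T x) (T y) < \<epsilon>"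
proof -
  obtain \<delta> where \<delta>: "\<delta> > 0"
    "\<And>x y. (x, y) \<in> R \<Longrightarrow> \<epsilon> \<le> dist x y \<Longrightarrow> dist x y < \<epsilon> + \<delta> \<Longrightarrow> dist (T x) (T y) < \<epsilon>"
    using assms unfolding meir_keeler_on_def by blast
  have decr: "dist (T x) (T y) < dist x y" if "(x, y) \<in> R" "x \<noteq> y" for x y
  proof -
    have "dist x y > 0" using that by simp
    then obtain \<delta>' where "\<delta>' > 0" "\<And>x' y'. (x', y') \<in> R \<Longrightarrow> dist x y \<le> dist x' y' \<Longrightarrow>
        dist x' y' < dist x y + \<delta>' \<Longrightarrow> dist (T x') (T y') < dist x y"
      using assms(1) unfolding meir_keeler_on_def by blast
    then show ?thesis using that by simp
  qed
  have "dist (T x) (T y) < \<epsilon>" if "(x, y) \<in> R" "dist x y < \<epsilon> + \<delta>" for x y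
  proof (cases "\<epsilon> \<le> dist x y")
    case True
    then show ?thesis using \<delta>(2) that by blast
  next
    case False
    then show ?thesis using decr[OF that(1)] assms(2) by (cases "x = y") auto
  qed
  then show ?thesis using \<delta>(1) by blast
qed

lemma gauge_of_uniform:
  fixes R :: "('a::metric_space \<times> 'a) set"
  assumes unif: "\<And>\<epsilon>. \<epsilon> > 0 \<Longrightarrow>
    \<exists>\<delta>>0. \<forall>(x, y)\<in>R. dist x y < \<epsilon> + \<delta> \<longrightarrow> dist (T x) (T y) < \<epsilon>"
  obtains w :: "real \<Rightarrow> real" where "mono_on {0..} w" and "w \<in> {0..} \<rightarrow> {0..}"
    and "\<And>s. s > 0 \<Longrightarrow> s < w s" and "\<And>s. s > 0 \<Longrightarrow> w s \<le> 2 * s"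
    and "\<And>x y. (x, y) \<in> R \<Longrightarrow> w (dist (T x) (T y)) \<le> dist x y"
proof -
  define A where "A = (\<lambda>s. {dist x y |x y. (x, y) \<in> R \<and> s \<le> dist (T x) (T y)})"
  define w where "w = (\<lambda>s. Inf (insert (2 * s) (A s)))"
  have bdd: "bdd_below (insert (2 * s) (A s))" for s
    by (rule bdd_belowI[of _ "min 0 (2 * s)"]) (auto simp: A_def min_le_iff_disj)
  have le: "w s \<le> a" if "a \<in> insert (2 * s) (A s)" for s a
    unfolding w_def using bdd that by (intro cInf_lower)
  have ge: "c \<le> w s" if "\<And>a. a \<in> insert (2 * s) (A s) \<Longrightarrow> c \<le> a" for s c
    unfolding w_def using that by (intro cInf_greatest) auto
  show thesis
  proof
    show "mono_on {0..} w"
    proof (rule mono_onI)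
      fix s s' :: real assume s: "s \<le> s'"
      show "w s \<le> w s'"
      proof (rule ge)
        fix a assume "a \<in> insert (2 * s') (A s')"
        then consider "a = 2 * s'" | "a \<in> A s" using s by (force simp: A_def)
        then show "w s \<le> a"
        proof cases
          case 1
          then show ?thesis using le[of "2 * s" s] s by simp
        qed (simp add: le)
      qed
    qed
    show "w \<in> {0..} \<rightarrow> {0..}"
      by (auto intro!: ge simp: A_def)
    show "s < w s" if s: "s > 0" for s
    proof -
      obtain \<delta> where \<delta>: "\<delta> > 0"
        "\<And>x y. (x, y) \<in> R \<Longrightarrow> dist x y < s + \<delta> \<Longrightarrow> dist (T x) (T y) < s"
        using unif[OF s] by blast
      have "min (2 * s) (s + \<delta>) \<le> w s"
        by (rule ge) (use \<delta>(2) in \<open>force simp: A_def min_le_iff_disj\<close>)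
      then show ?thesis using s \<delta>(1) by linarith
    qed
    show "w s \<le> 2 * s" for s by (simp add: le)
    show "w (dist (T x) (T y)) \<le> dist x y" if "(x, y) \<in> R" for x y
      by (rule le) (use that in \<open>auto simp: A_def\<close>)
  qed
qed

lemma right_lsc_at_of_mono_on:
  assumes "mono_on {0..} w" "t > 0"
  shows "right_lsc_at t w"
  unfolding right_lsc_at_def
proof (intro allI impI)
  fix \<epsilon> :: real assume \<epsilon>: "\<epsilon> > 0"
  have "w t - \<epsilon> < w s" if "t \<le> s" for s
    using mono_onD[OF assms(1), of t s] that \<epsilon> assms(2) by auto
  then show "\<exists>\<delta>>0. \<forall>s\<in>{t..<t + \<delta>}. w t - \<epsilon> < w s"
    by (intro exI[of _ 1]) auto
qed

text \<open>
  If \<open>Tx = Ty\<close>, the strict inequality is the positivity of \<open>l\<close>; otherwise it comes from the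
  point \<open>u\<close> beyond \<open>d(Tx,Ty)\<close> up to which the delayed gauge stays below \<open>d(x,y)\<close>.
\<close>

lemma type_L_of_gauge:
  fixes R :: "('a::metric_space \<times> 'a) set"
  assumes mono: "mono_on {0..} w" and above: "\<And>s. s > 0 \<Longrightarrow> s < w s"
    and upper: "\<And>s. s > 0 \<Longrightarrow> w s \<le> 2 * s"
    and R: "\<And>x y. (x, y) \<in> R \<Longrightarrow> w (dist (T x) (T y)) \<le> dist x y"
  shows "\<exists>l :: real \<Rightarrow> real. l \<in> {0<..} \<rightarrow> {0..} \<and> type_L l
          \<and> (\<forall>(x, y)\<in>R. x \<noteq> y \<longrightarrow> dist (T x) (T y) < l (dist x y))
          \<and> (\<forall>s>0. continuous (at_right s) l) \<and> mono_on {0<..} l \<and> (\<forall>s>0. l s > 0)"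
proof -
  obtain h where h: "mono_on {0<..} h" "\<And>s. s > 0 \<Longrightarrow> s < h s" "\<And>s. s > 0 \<Longrightarrow> h s \<le> w s"
    "\<And>b. b > 0 \<Longrightarrow> \<exists>u>b. h u \<le> w b"
    using exists_delayed_gauge[OF mono above] by blast
  have h2: "h s \<le> 2 * s" if "s > 0" for s
    using h(3)[OF that] upper[OF that] by linarith
  define l where "l = generalized_inverse h"
  note l = generalized_inverse_type_L[OF h(1,2) h2, folded l_def]
  have "dist (T x) (T y) < l (dist x y)" if xy: "(x, y) \<in> R" "x \<noteq> y" for x y
  proof (cases "T x = T y")
    case True
    then show ?thesis using l(3) xy by simp
  next
    case False
    then obtain u where u: "dist (T x) (T y) < u" "h u \<le> w (dist (T x) (T y))"
      using h(4)[of "dist (T x) (T y)"] by auto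
    moreover have "0 < u" using u(1) zero_le_dist by (rule le_less_trans[rotated])
    ultimately have "u \<le> l (dist x y)"
      using l(5)[of "dist x y" u] R[OF xy(1)] xy(2) by auto
    then show ?thesis using u(1) by simp
  qed
  moreover have "l \<in> {0<..} \<rightarrow> {0..}" using l(3) by (auto intro: less_imp_le)
  ultimately show ?thesis using l(1-4) by (intro exI[of _ l]) auto
qed

section \<open>From the characterizations to the Meir--Keeler condition\<close>

lemma meir_keeler_on_of_right_lsc:
  assumes above: "\<And>s. s > 0 \<Longrightarrow> s < w s" and lsc: "\<And>t. t > 0 \<Longrightarrow> right_lsc_at t w"
    and R: "\<And>x y. (x, y) \<in> R \<Longrightarrow> w (dist (T x) (T y)) \<le> dist x y"
  shows "meir_keeler_on R T"
  unfolding meir_keeler_on_def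
proof (intro allI impI)
  fix \<epsilon> :: real assume \<epsilon>: "\<epsilon> > 0"
  define \<eta> where "\<eta> = (w \<epsilon> - \<epsilon>) / 2"
  have \<eta>: "\<eta> > 0" using above[OF \<epsilon>] by (simp add: \<eta>_def)
  then obtain \<delta> where \<delta>: "\<delta> > 0" "\<And>s. \<epsilon> \<le> s \<Longrightarrow> s < \<epsilon> + \<delta> \<Longrightarrow> w \<epsilon> - \<eta> < w s"
    using lsc[OF \<epsilon>] unfolding right_lsc_at_def by fastforce
  have "dist (T x) (T y) < \<epsilon>" if xy: "(x, y) \<in> R" "dist x y < \<epsilon> + min \<delta> \<eta>" for x y
  proof (rule ccontr)
    assume b: "\<not> dist (T x) (T y) < \<epsilon>"
    \<comment> \<open>Then \<open>d(Tx,Ty) < w(d(Tx,Ty)) \<le> d(x,y)\<close> places \<open>d(Tx,Ty)\<close> in the range of \<open>\<delta>\<close>.\<close>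
    have "dist (T x) (T y) < w (dist (T x) (T y))" using b \<epsilon> by (intro above) linarith
    then have "w \<epsilon> - \<eta> < w (dist (T x) (T y))" using \<delta>(2) b xy R[OF xy(1)] by simp
    moreover have "w \<epsilon> - \<eta> = \<epsilon> + \<eta>" by (simp add: \<eta>_def field_simps)
    ultimately show False using R[OF xy(1)] xy(2) by simp
  qed
  then show "\<exists>\<delta>>0. \<forall>(x, y)\<in>R.
      \<epsilon> \<le> dist x y \<and> dist x y < \<epsilon> + \<delta> \<longrightarrow> dist (T x) (T y) < \<epsilon>"
    using \<delta>(1) \<eta> by (intro exI[of _ "min \<delta> \<eta>"]) auto
qed

lemma meir_keeler_on_of_type_L:
  assumes L: "type_L l"
    and R: "\<And>x y. (x, y) \<in> R \<Longrightarrow> x \<noteq> y \<Longrightarrow> dist (T x) (T y) < l (dist x y)"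
  shows "meir_keeler_on R T"
  unfolding meir_keeler_on_def
proof (intro allI impI)
  fix \<epsilon> :: real assume \<epsilon>: "\<epsilon> > 0"
  obtain \<delta> where \<delta>: "\<delta> > 0" "\<And>t. \<epsilon> \<le> t \<Longrightarrow> t \<le> \<epsilon> + \<delta> \<Longrightarrow> l t \<le> \<epsilon>"
    using L \<epsilon> unfolding type_L_def by fastforce
  have "dist (T x) (T y) < \<epsilon>" if "(x, y) \<in> R" "\<epsilon> \<le> dist x y" "dist x y < \<epsilon> + \<delta>" for x y
  proof -
    have "x \<noteq> y" using that(2) \<epsilon> by auto
    then have "dist (T x) (T y) < l (dist x y)" using R that(1) by blast
    also have "\<dots> \<le> \<epsilon>" using \<delta>(2) that by simp
    finally show ?thesis .
  qed
  then show "\<exists>\<delta>>0. \<forall>(x, y)\<in>R.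
      \<epsilon> \<le> dist x y \<and> dist x y < \<epsilon> + \<delta> \<longrightarrow> dist (T x) (T y) < \<epsilon>"
    using \<delta>(1) by blast
qed

text \<open>
  If \<open>d(Tx,Ty) \<ge> \<epsilon>\<close>, then \<open>\<psi>(d(x,y)) \<ge> \<phi>(\<epsilon>) > \<psi>(\<epsilon>)\<close>, which right upper semicontinuity of \<open>\<psi>\<close>
  excludes for \<open>d(x,y)\<close> slightly above \<open>\<epsilon>\<close>.
\<close>

lemma meir_keeler_on_of_right_usc:
  fixes \<phi> :: "real \<Rightarrow> ennreal"
  assumes mono: "mono_on {0..} \<phi>" and pos: "\<psi> \<in> {0..} \<rightarrow> {0..}"
    and usc: "\<And>t. t > 0 \<Longrightarrow> right_usc_at t \<psi>"
    and gt: "\<And>t. t > 0 \<Longrightarrow> \<phi> t > ennreal (\<psi> t)"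
    and R: "\<And>x y. (x, y) \<in> R \<Longrightarrow> \<phi> (dist (T x) (T y)) \<le> ennreal (\<psi> (dist x y))"
  shows "meir_keeler_on R T"
  unfolding meir_keeler_on_def
proof (intro allI impI)
  fix \<epsilon> :: real assume \<epsilon>: "\<epsilon> > 0"
  obtain c where c: "ennreal (\<psi> \<epsilon>) < c" "c < \<phi> \<epsilon>" using dense gt[OF \<epsilon>] by blast
  then obtain r where r: "c = ennreal r" "0 \<le> r" by (cases c) auto
  have "\<psi> \<epsilon> < r" using c(1) r pos \<epsilon> by (auto simp: ennreal_less_iff Pi_iff)
  then obtain \<delta> where \<delta>: "\<delta> > 0" "\<forall>s\<in>{\<epsilon>..<\<epsilon> + \<delta>}. - \<psi> \<epsilon> - (r - \<psi> \<epsilon>) < - \<psi> s"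
    using usc[OF \<epsilon>] unfolding right_usc_at_def right_lsc_at_def
    by (metis diff_gt_0_iff_gt)
  have "dist (T x) (T y) < \<epsilon>" if xy: "(x, y) \<in> R" "\<epsilon> \<le> dist x y" "dist x y < \<epsilon> + \<delta>" for x y
  proof (rule ccontr)
    assume b: "\<not> dist (T x) (T y) < \<epsilon>"
    have "c < \<phi> \<epsilon>" by fact
    also have "\<phi> \<epsilon> \<le> \<phi> (dist (T x) (T y))" using b \<epsilon> by (intro mono_onD[OF mono]) auto
    also have "\<dots> \<le> ennreal (\<psi> (dist x y))" using R xy(1) by blast
    also have "\<dots> \<le> c" unfolding r(1) using \<delta>(2) xy by (intro ennreal_leI) force
    finally show False by simp
  qed
  then show "\<exists>\<delta>>0. \<forall>(x, y)\<in>R.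
      \<epsilon> \<le> dist x y \<and> dist x y < \<epsilon> + \<delta> \<longrightarrow> dist (T x) (T y) < \<epsilon>"
    using \<delta>(1) by blast
qed

lemma right_usc_at_ident: "right_usc_at t (\<lambda>s. s)"
  unfolding right_usc_at_def right_lsc_at_def
proof (intro allI impI)
  fix \<epsilon> :: real assume "\<epsilon> > 0"
  then show "\<exists>\<delta>>0. \<forall>s\<in>{t..<t + \<delta>}. - t - \<epsilon> < - s"
    by (intro exI[of _ \<epsilon>]) auto
qed

section \<open>Equivalence of the characterizations\<close>

theorem theorem3p1:
  fixes T :: "'a::metric_space \<Rightarrow> 'a" and R :: "('a \<times> 'a) set"
  assumes "R \<noteq> {}"
  shows
    "(meir_keeler_on R T \<longleftrightarrow>
       (\<forall>\<epsilon>>0. \<exists>\<delta>>0. \<forall>(x, y)\<in>R. dist x y < \<epsilon> + \<delta> \<longrightarrow> dist (T x) (T y) < \<epsilon>))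
     \<and> (meir_keeler_on R T \<longleftrightarrow>
       (\<exists>\<gamma> :: real \<Rightarrow> ennreal. mono_on {0..} \<gamma> \<and> (\<forall>s>0. \<gamma> s > ennreal s)
          \<and> (\<forall>(x, y)\<in>R. \<gamma> (dist (T x) (T y)) \<le> ennreal (dist x y))))
     \<and> (meir_keeler_on R T \<longleftrightarrow>
       (\<exists>w :: real \<Rightarrow> real. w \<in> {0..} \<rightarrow> {0..} \<and> (\<forall>s>0. w s > s)
          \<and> (\<forall>t>0. right_lsc_at t w)
          \<and> (\<forall>(x, y)\<in>R. w (dist (T x) (T y)) \<le> dist x y)))
     \<and> (meir_keeler_on R T \<longleftrightarrow>
       (\<exists>l :: real \<Rightarrow> real. l \<in> {0<..} \<rightarrow> {0..} \<and> type_L l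
          \<and> (\<forall>(x, y)\<in>R. x \<noteq> y \<longrightarrow> dist (T x) (T y) < l (dist x y))))
     \<and> (meir_keeler_on R T \<longleftrightarrow>
       (\<exists>(\<phi> :: real \<Rightarrow> ennreal) (\<psi> :: real \<Rightarrow> real).
          mono_on {0..} \<phi> \<and> \<psi> \<in> {0..} \<rightarrow> {0..}
          \<and> (\<forall>t>0. right_usc_at t \<psi>)
          \<and> (\<forall>t>0. \<phi> t > ennreal (\<psi> t))
          \<and> (\<forall>(x, y)\<in>R. \<phi> (dist (T x) (T y)) \<le> ennreal (\<psi> (dist x y)))))
     \<and> (meir_keeler_on R T \<longrightarrow>
       (\<exists>l :: real \<Rightarrow> real. l \<in> {0<..} \<rightarrow> {0..} \<and> type_L l
          \<and> (\<forall>(x, y)\<in>R. x \<noteq> y \<longrightarrow> dist (T x) (T y) < l (dist x y))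
          \<and> (\<forall>s>0. continuous (at_right s) l) \<and> mono_on {0<..} l \<and> (\<forall>s>0. l s > 0)))"
proof -
  let ?C2 = "\<forall>\<epsilon>>0. \<exists>\<delta>>0. \<forall>(x, y)\<in>R. dist x y < \<epsilon> + \<delta> \<longrightarrow> dist (T x) (T y) < \<epsilon>"
  let ?P3 = "\<lambda>\<gamma> :: real \<Rightarrow> ennreal. mono_on {0..} \<gamma> \<and> (\<forall>s>0. \<gamma> s > ennreal s)
          \<and> (\<forall>(x, y)\<in>R. \<gamma> (dist (T x) (T y)) \<le> ennreal (dist x y))"
  let ?P4 = "\<lambda>w :: real \<Rightarrow> real. w \<in> {0..} \<rightarrow> {0..} \<and> (\<forall>s>0. w s > s)
          \<and> (\<forall>t>0. right_lsc_at t w)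
          \<and> (\<forall>(x, y)\<in>R. w (dist (T x) (T y)) \<le> dist x y)"
  let ?P5 = "\<lambda>l :: real \<Rightarrow> real. l \<in> {0<..} \<rightarrow> {0..} \<and> type_L l
          \<and> (\<forall>(x, y)\<in>R. x \<noteq> y \<longrightarrow> dist (T x) (T y) < l (dist x y))"
  let ?P6 = "\<lambda>(\<phi> :: real \<Rightarrow> ennreal) (\<psi> :: real \<Rightarrow> real).
          mono_on {0..} \<phi> \<and> \<psi> \<in> {0..} \<rightarrow> {0..}
          \<and> (\<forall>t>0. right_usc_at t \<psi>)
          \<and> (\<forall>t>0. \<phi> t > ennreal (\<psi> t))
          \<and> (\<forall>(x, y)\<in>R. \<phi> (dist (T x) (T y)) \<le> ennreal (\<psi> (dist x y)))"
  let ?P5' = "\<lambda>l :: real \<Rightarrow> real. l \<in> {0<..} \<rightarrow> {0..} \<and> type_L l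
          \<and> (\<forall>(x, y)\<in>R. x \<noteq> y \<longrightarrow> dist (T x) (T y) < l (dist x y))
          \<and> (\<forall>s>0. continuous (at_right s) l) \<and> mono_on {0<..} l \<and> (\<forall>s>0. l s > 0)"
  have fwd: "?C2 \<and> Ex ?P3 \<and> Ex ?P4 \<and> Ex ?P5'" if mk: "meir_keeler_on R T"
  proof -
    have C2: ?C2 using meir_keeler_on_uniform[OF mk] by blast
    obtain w where w: "mono_on {0..} w" "w \<in> {0..} \<rightarrow> {0..}"
      "\<And>s. s > 0 \<Longrightarrow> s < w s" "\<And>s. s > 0 \<Longrightarrow> w s \<le> 2 * s"
      "\<And>x y. (x, y) \<in> R \<Longrightarrow> w (dist (T x) (T y)) \<le> dist x y"
      using gauge_of_uniform[OF meir_keeler_on_uniform[OF mk]] by blast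
    have "?P3 (\<lambda>s. ennreal (w s))"
    proof (intro conjI)
      show "mono_on {0..} (\<lambda>s. ennreal (w s))"
        using w(1) by (auto intro!: mono_onI ennreal_leI dest: mono_onD)
      show "\<forall>s>0. ennreal (w s) > ennreal s"
        using w(3) by (auto simp: ennreal_less_iff)
      show "\<forall>(x, y)\<in>R. ennreal (w (dist (T x) (T y))) \<le> ennreal (dist x y)"
        using w(5) by (auto intro: ennreal_leI)
    qed
    moreover have "?P4 w" using w right_lsc_at_of_mono_on[OF w(1)] by auto
    moreover have "Ex ?P5'" using w by (intro type_L_of_gauge) auto
    ultimately show ?thesis using C2 by blast
  qed
  have from2: "meir_keeler_on R T" if ?C2
    using that unfolding meir_keeler_on_def by (metis (mono_tags, lifting) case_prodD case_prodI2)
  \<comment> \<open>A function \<open>\<gamma>\<close> is a \<open>\<phi>\<close> whose partner \<open>\<psi>\<close> is the identity.\<close>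
  have from3: "Ex (?P6 \<gamma>)" if "?P3 \<gamma>" for \<gamma>
    using that right_usc_at_ident by (intro exI[of _ "\<lambda>s. s"]) auto
  have from4: "meir_keeler_on R T" if "?P4 w" for w
    by (rule meir_keeler_on_of_right_lsc[of w]) (use that in auto)
  have from5: "meir_keeler_on R T" if "?P5 l" for l
    by (rule meir_keeler_on_of_type_L[of l]) (use that in auto)
  have from6: "meir_keeler_on R T" if "?P6 \<phi> \<psi>" for \<phi> \<psi>
    by (rule meir_keeler_on_of_right_usc[of \<phi> \<psi>]) (use that in auto)
  have weaken: "Ex ?P5" if "Ex ?P5'"
    using that by (elim exE conjE, intro exI conjI)
  have to3: "Ex ?P3" if "meir_keeler_on R T"
    using fwd[OF that] by (elim conjE)
  have eq2: "meir_keeler_on R T \<longleftrightarrow> ?C2"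
    by (rule iffI[OF conjunct1[OF fwd] from2])
  have eq3: "meir_keeler_on R T \<longleftrightarrow> Ex ?P3"
    by (rule iffI[OF to3]) (assumption, elim exE, drule from3, elim exE, rule from6)
  have eq4: "meir_keeler_on R T \<longleftrightarrow> Ex ?P4"
  proof (rule iffI)
    show "Ex ?P4" if "meir_keeler_on R T" using fwd[OF that] by (elim conjE)
  qed (elim exE, rule from4)
  have more: "meir_keeler_on R T \<longrightarrow> Ex ?P5'"
    by (rule impI) (drule fwd, elim conjE)
  have eq5: "meir_keeler_on R T \<longleftrightarrow> Ex ?P5"
  proof (rule iffI)
    show "Ex ?P5" if "meir_keeler_on R T" by (rule weaken[OF mp[OF more that]])
  qed (elim exE, rule from5)
  have eq6: "meir_keeler_on R T \<longleftrightarrow> (\<exists>\<phi> \<psi>. ?P6 \<phi> \<psi>)"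
  proof (rule iffI)
    show "\<exists>\<phi> \<psi>. ?P6 \<phi> \<psi>" if "meir_keeler_on R T"
      using to3[OF that] by (elim exE) (rule exI, rule from3)
  qed (elim exE, rule from6)
  show ?thesis by (intro conjI eq2 eq3 eq4 eq5 eq6 more)
qed

end
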